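(* Let $0<\alpha\le 2$, $\nu>0$, let $(a_z)_{z\ge 1}$ and $\theta>0$ be as in the context, let $k=\frac{\alpha-1}{\alpha}$, and let $r$ be a positive integer. If $Y$ has the rGTL-PS distribution with parameters $(\alpha,\nu,\theta)$, then $$E(Y^r)=\sum_{z=1}^{\infty}\frac{a_z\theta^z}{A(\theta)}\,\alpha^{\nu z-1}\,\Gamma(\nu z+1)\sum_{h=0}^{\infty}\frac{(-k)^h}{\Gamma(\nu z-h)\,h!}\left[(2-\alpha)+\frac{2(\alpha-1)(r+1)}{\nu z+h+r+1}\right]B(r+1,\nu z+h).$$
   Context: For $0<\alpha\le 2$ and $\nu>0$, the reflected Generalized Topp-Leone distribution rGTL$(\alpha,\nu)$ on $[0,1]$ has cdf $G(y;\alpha,\nu)=1-(1-y)^{\nu}[\alpha-(\alpha-1)(1-y)]^{\nu}$ and density $g(y;\alpha,\nu)=\nu(1-y)^{\nu-1}[\alpha-(\alpha-1)(1-y)]^{\nu-1}[\alpha-2(\alpha-1)(1-y)]$. Let $a_z\ge 0$ ($z=1,2,\dots$) and $\theta>0$ be such that $A(\theta)=\sum_{z=1}^{\infty}a_z\theta^z$ is finite (and positive). Let $Z$ have the zero-truncated power series distribution $P(Z=z)=a_z\theta^z/A(\theta)$, $z=1,2,\dots$. The rGTL-PS distribution with parameters $(\alpha,\nu,\theta)$ is the law of $\min\{Y_1,\dots,Y_Z\}$, where $Y_1,Y_2,\dots$ are i.i.d. rGTL$(\alpha,\nu)$ and independent of $Z$. Its density on $[0,1]$ is $f(y)=\theta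 g(y;\alpha,\nu)A'\{\theta[1-G(y;\alpha,\nu)]\}/A(\theta)=\sum_{z\ge1}\frac{a_z\theta^z}{A(\theta)}g(y;\alpha,\nu z)$. $\Gamma$ is the Gamma function, with the convention $1/\Gamma(x)=0$ when $x$ is a nonpositive integer, and $B(a,b)=\int_0^1 y^{a-1}(1-y)^{b-1}\,dy$.
   Formalization: For α<1/2 it is additionally assumed that the inner series over h converges for every z with a_z≠0; otherwise (e.g. α=1/4, ν=1/2, a_1=1, other a_z=0) it diverges and the right-hand side is undefined. Nothing is added for α≥1/2. *)

theory Defs
  imports "HOL-Probability.Probability"
begin

definition rGTL_density :: "real \<Rightarrow> real \<Rightarrow> real \<Rightarrow> real" where
  "rGTL_density \<alpha> \<nu> y =
     \<nu> * (1 - y) powr (\<nu> - 1) * (\<alpha> - (\<alpha> - 1) * (1 - y)) powr (\<nu> - 1)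
       * (\<alpha> - 2 * (\<alpha> - 1) * (1 - y))"

definition rGTL :: "real \<Rightarrow> real \<Rightarrow> real measure" where
  "rGTL \<alpha> \<nu> = density lborel (\<lambda>y. ennreal (rGTL_density \<alpha> \<nu> y * indicator {0..1} y))"

text \<open>Only the coefficients \<open>a z\<close> with \<open>z \<ge> 1\<close> are ever used; \<open>a 0\<close> is irrelevant.\<close>

definition PS_norm :: "(nat \<Rightarrow> real) \<Rightarrow> real \<Rightarrow> real" where
  "PS_norm a \<theta> = (\<Sum>n. a (Suc n) * \<theta> ^ Suc n)"

definition PS_prob :: "(nat \<Rightarrow> real) \<Rightarrow> real \<Rightarrow> nat \<Rightarrow> real" where
  "PS_prob a \<theta> z = (if z \<ge> 1 then a z * \<theta> ^ z / PS_norm a \<theta> else 0)"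

definition power_series_dist :: "(nat \<Rightarrow> real) \<Rightarrow> real \<Rightarrow> nat measure" where
  "power_series_dist a \<theta> = point_measure UNIV (\<lambda>z. ennreal (PS_prob a \<theta> z))"

text \<open>The law of the minimum of \<open>Y 1, \<dots>, Y Z\<close>. The product measure makes the \<open>Y i\<close> i.i.d. and
  independent of \<open>Z\<close>; the value of \<open>Min\<close> at \<open>Z = 0\<close> does not matter, as that event is null.\<close>

definition rGTL_PS :: "real \<Rightarrow> real \<Rightarrow> (nat \<Rightarrow> real) \<Rightarrow> real \<Rightarrow> real measure" where
  "rGTL_PS \<alpha> \<nu> a \<theta> =
     distr (power_series_dist a \<theta> \<Otimes>\<^sub>M (\<Pi>\<^sub>M i\<in>{1::nat..}. rGTL \<alpha> \<nu>)) borel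
       (\<lambda>(z, y). Min (y ` {1..z}))"

text \<open>The \<open>h\<close>-th term of the inner series of the moment formula, where \<open>s\<close> stands for \<open>\<nu> z\<close>.
  \<open>rGamma\<close> is \<open>1 / Gamma\<close>, extended by \<open>0\<close> to the nonpositive integers.\<close>

definition moment_term :: "real \<Rightarrow> nat \<Rightarrow> real \<Rightarrow> nat \<Rightarrow> real" where
  "moment_term \<alpha> r s h =
     (let k = (\<alpha> - 1) / \<alpha> in
        (- k) ^ h * rGamma (s - real h) / fact h
          * ((2 - \<alpha>) + 2 * (\<alpha> - 1) * (real r + 1) / (s + real h + real r + 1))
          * Beta (real r + 1) (s + real h))"

end

(* The survival function of rGTL(\<alpha>, \<nu>) is the \<nu>-th power of one that does not depend on \<nu>, so the
   minimum of z independent copies has law rGTL(\<alpha>, \<nu> z), and rGTL-PS is a mixture of these laws.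
   With u = 1 - y and k = (\<alpha> - 1) / \<alpha>, the density of rGTL(\<alpha>, s) contains (1 - k u)^(s - 1), which is
   expanded in its binomial series and integrated term by term against Beta integrals.
   For \<alpha> \<ge> 1/2 we have |k| \<le> 1, and the integrated series converges absolutely like the sum of 1/h^2.
   For \<alpha> < 1/2 we have |k| > 1, and the ratio of successive terms tends to |k| in absolute value; so the
   assumed convergence forces s to be a positive integer, and the binomial series is a finite sum. *)
theory Submission
  imports Defs "HOL-Real_Asymp.Real_Asymp"
begin

section \<open>The density of rGTL and its tail\<close>

lemma affine_unit_pos:
  fixes \<alpha> u :: real
  assumes "0 < \<alpha>" "0 < u" "u \<le> 1"
  shows "0 < \<alpha> - (\<alpha> - 1) * u"
proof -
  have "\<alpha> - (\<alpha> - 1) * u = \<alpha> * (1 - u) + u" by (simp add: algebra_simps)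
  then show ?thesis using assms by (simp add: add_nonneg_pos)
qed

text \<open>A convex combination of \<alpha> and 2 - \<alpha>; this is the factor through which
  \<alpha> \<le> 2 makes the density nonnegative.\<close>

lemma affine_unit_nonneg:
  fixes \<alpha> u :: real
  assumes "0 < \<alpha>" "\<alpha> \<le> 2" "0 \<le> u" "u \<le> 1"
  shows "0 \<le> \<alpha> - 2 * (\<alpha> - 1) * u"
proof -
  have "\<alpha> - 2 * (\<alpha> - 1) * u = \<alpha> * (1 - u) + (2 - \<alpha>) * u" by (simp add: algebra_simps)
  then show ?thesis using assms by simp
qed

lemma rGTL_density_nonneg:
  assumes "0 < \<alpha>" "\<alpha> \<le> 2" "0 < \<nu>" "0 \<le> y" "y \<le> 1"
  shows "0 \<le> rGTL_density \<alpha> \<nu> y"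
  using assms affine_unit_nonneg[of \<alpha> "1 - y"] by (simp add: rGTL_density_def)

lemma rGTL_density_measurable [measurable]: "rGTL_density \<alpha> \<nu> \<in> borel_measurable borel"
  unfolding rGTL_density_def by measurable

lemma sets_rGTL [simp, measurable_cong]: "sets (rGTL \<alpha> \<nu>) = sets borel"
  by (simp add: rGTL_def)

lemma space_rGTL [simp]: "space (rGTL \<alpha> \<nu>) = UNIV"
  by (simp add: rGTL_def)

text \<open>The survival function \<open>1 - G(t; \<alpha>, 1)\<close>, with \<open>t\<close> clamped to the support \<open>[0, 1]\<close>.\<close>

definition rGTL_base :: "real \<Rightarrow> real \<Rightarrow> real" where
  "rGTL_base \<alpha> t = (let u = 1 - max 0 (min 1 t) in u * (\<alpha> - (\<alpha> - 1) * u))"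

text \<open>The density is the derivative of minus the survival function. For \<nu> < 1 it is
  unbounded near 1, so the fundamental theorem of calculus is applied on an open interval, in the
  version for nonnegative integrands with one-sided limits at the ends.\<close>

lemma emeasure_rGTL_greaterThan:
  assumes \<alpha>: "0 < \<alpha>" "\<alpha> \<le> 2" and \<nu>: "0 < \<nu>"
  shows "emeasure (rGTL \<alpha> \<nu>) {t<..} = ennreal (rGTL_base \<alpha> t powr \<nu>)"
proof -
  define c where "c = max 0 (min 1 t)"
  define F where "F y = - (((1 - y) * (\<alpha> - (\<alpha> - 1) * (1 - y))) powr \<nu>)" for y
  have em: "emeasure (rGTL \<alpha> \<nu>) {t<..} =
      (\<integral>\<^sup>+y. ennreal (rGTL_density \<alpha> \<nu> y * indicator {0..1} y) * indicator {t<..} y \<partial>lborel)"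
    unfolding rGTL_def by (subst emeasure_density) simp_all
  \<comment> \<open>The two domains of integration differ at most in the points 0 and 1, which are
    null.\<close>
  also have "\<dots> = (\<integral>\<^sup>+y. ennreal (indicator {c<..<1} y * rGTL_density \<alpha> \<nu> y) \<partial>lborel)"
  proof (rule nn_integral_cong_AE)
    have "AE y in lborel. y \<noteq> 0 \<and> y \<noteq> (1::real)"
      using AE_lborel_singleton[of "0::real"] AE_lborel_singleton[of "1::real"] by eventually_elim simp
    then show "AE y in lborel. ennreal (rGTL_density \<alpha> \<nu> y * indicator {0..1} y) * indicator {t<..} y =
        ennreal (indicator {c<..<1} y * rGTL_density \<alpha> \<nu> y)"
      by eventually_elim (auto simp: c_def indicator_def max_def min_def split: if_splits)
  qed
  also have "\<dots> = ennreal (rGTL_base \<alpha> t powr \<nu>)"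
  proof (cases "c < 1")
    case True
    have c0: "0 \<le> c" by (simp add: c_def)
    have der: "(F has_real_derivative rGTL_density \<alpha> \<nu> x) (at x)" if "c < x" "x < 1" for x
    proof -
      have p: "0 < \<alpha> - (\<alpha> - 1) * (1 - x)" and q: "0 < 1 - x"
        using affine_unit_pos[of \<alpha> "1 - x"] \<alpha> that c0 by auto
      have b: "((\<lambda>y. (1 - y) * (\<alpha> - (\<alpha> - 1) * (1 - y))) has_real_derivative
          - (\<alpha> - (\<alpha> - 1) * (1 - x)) + (1 - x) * (\<alpha> - 1)) (at x)"
        by (auto intro!: derivative_eq_intros simp: algebra_simps)
      have "(F has_real_derivative
          - (\<nu> * ((1 - x) * (\<alpha> - (\<alpha> - 1) * (1 - x))) powr (\<nu> - 1) *
            (- (\<alpha> - (\<alpha> - 1) * (1 - x)) + (1 - x) * (\<alpha> - 1)))) (at x)"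
        unfolding F_def using DERIV_minus[OF DERIV_fun_powr[OF b mult_pos_pos[OF q p], of \<nu>]] by simp
      moreover have "- (\<nu> * ((1 - x) * (\<alpha> - (\<alpha> - 1) * (1 - x))) powr (\<nu> - 1) *
            (- (\<alpha> - (\<alpha> - 1) * (1 - x)) + (1 - x) * (\<alpha> - 1))) = rGTL_density \<alpha> \<nu> x"
        unfolding rGTL_density_def powr_mult by (simp add: algebra_simps)
      ultimately show ?thesis by simp
    qed
    have cont: "isCont (rGTL_density \<alpha> \<nu>) x" if "c < x" "x < 1" for x
      unfolding rGTL_density_def[abs_def] using affine_unit_pos[of \<alpha> "1 - x"] \<alpha> that c0
      by (auto intro!: continuous_intros)
    have nn: "0 \<le> rGTL_density \<alpha> \<nu> x" if "c < x" "x < 1" for x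
      using rGTL_density_nonneg[OF \<alpha> \<nu>] that c0 by simp
    have lim: "((F \<circ> real_of_ereal) \<longlongrightarrow> F c) (at_right (ereal c))"
    proof -
      have "isCont F c"
        unfolding F_def[abs_def] using affine_unit_pos[of \<alpha> "1 - c"] \<alpha> True c0
        by (auto intro!: continuous_intros)
      then show ?thesis
        unfolding ereal_tendsto_simps1 isCont_def by (rule filterlim_mono[OF _ order_refl at_le]) simp
    qed
    \<comment> \<open>At 1 the base of the power is 0; the limit still exists because \<nu> > 0 and
      the base is nonnegative to the left of 1.\<close>
    have lim1: "((F \<circ> real_of_ereal) \<longlongrightarrow> F 1) (at_left (ereal 1))"
    proof -
      have "eventually (\<lambda>x. x \<in> {0<..<1}) (at_left (1::real))"
        by (rule eventually_at_leftI[of 0]) auto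
      then have "eventually (\<lambda>x. 0 \<le> (1 - x) * (\<alpha> - (\<alpha> - 1) * (1 - x))) (at_left 1)"
        by eventually_elim (use affine_unit_pos \<alpha> in \<open>auto intro!: mult_nonneg_nonneg less_imp_le\<close>)
      then show ?thesis
        unfolding ereal_tendsto_simps1 F_def using \<nu>
        by (intro tendsto_minus tendsto_powr' tendsto_intros) auto
    qed
    have "set_integrable lborel (einterval (ereal c) (ereal 1)) (rGTL_density \<alpha> \<nu>)"
        "(LBINT x=ereal c..ereal 1. rGTL_density \<alpha> \<nu> x) = F 1 - F c"
      using interval_integral_FTC_nonneg[of "ereal c" "ereal 1" F "rGTL_density \<alpha> \<nu>" "F c" "F 1"]
        True der cont nn lim lim1 by auto
    then have I: "integrable lborel (\<lambda>y. indicator {c<..<1} y * rGTL_density \<alpha> \<nu> y)"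
        "(\<integral>y. indicator {c<..<1} y * rGTL_density \<alpha> \<nu> y \<partial>lborel) = F 1 - F c"
      using True
      by (simp_all add: interval_integral_Ioo set_integrable_def set_lebesgue_integral_def)
    have "(\<integral>\<^sup>+y. ennreal (indicator {c<..<1} y * rGTL_density \<alpha> \<nu> y) \<partial>lborel) = ennreal (F 1 - F c)"
      unfolding I(2)[symmetric] by (rule nn_integral_eq_integral[OF I(1)]) (auto simp: indicator_def nn)
    then show ?thesis by (simp add: F_def rGTL_base_def c_def Let_def)
  next
    case False
    then have "c = 1" by (auto simp: c_def)
    then show ?thesis by (simp add: rGTL_base_def c_def[symmetric])
  qed
  finally show ?thesis .
qed

lemma AE_rGTL: "AE y in rGTL \<alpha> \<nu>. y \<in> {0..1}"
  unfolding rGTL_def by (subst AE_density) (auto simp: indicator_def)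

lemma prob_space_rGTL:
  assumes "0 < \<alpha>" "\<alpha> \<le> 2" "0 < \<nu>"
  shows "prob_space (rGTL \<alpha> \<nu>)"
proof
  \<comment> \<open>Any point left of the support could replace -1: clamping gives u = 1 there, and
    the tail is 1.\<close>
  have "emeasure (rGTL \<alpha> \<nu>) (space (rGTL \<alpha> \<nu>)) = emeasure (rGTL \<alpha> \<nu>) {-1<..}"
    by (rule emeasure_eq_AE) (use AE_rGTL[of \<alpha> \<nu>] in auto)
  then show "emeasure (rGTL \<alpha> \<nu>) (space (rGTL \<alpha> \<nu>)) = 1"
    by (simp add: emeasure_rGTL_greaterThan[OF assms] rGTL_base_def)
qed

section \<open>Minima of independent copies and the mixture over Z\<close>

text \<open>The minimum exceeds t iff all z coordinates do, so independence turns its tail into the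
  z-th power of the rGTL tail, which is the tail with \<nu> z for \<nu>. Finite values on all open
  upper rays determine a law on the line.\<close>

lemma distr_Min_rGTL:
  assumes \<alpha>: "0 < \<alpha>" "\<alpha> \<le> 2" and \<nu>: "0 < \<nu>" and z: "1 \<le> z"
  shows "distr (\<Pi>\<^sub>M i\<in>{1::nat..}. rGTL \<alpha> \<nu>) borel (\<lambda>y. Min (y ` {1..z})) = rGTL \<alpha> (\<nu> * real z)"
    (is "distr ?P borel ?f = _")
proof (rule measure_eqI_lessThan)
  interpret product_prob_space "\<lambda>_. rGTL \<alpha> \<nu>" "{1::nat..}"
    by (simp add: product_prob_space_def product_prob_space_axioms_def product_sigma_finite_def
        prob_space_rGTL[OF \<alpha> \<nu>] prob_space_imp_sigma_finite)
  have meas [measurable]: "?f \<in> borel_measurable ?P"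
    by (intro borel_measurable_Min) auto
  have \<nu>z: "0 < \<nu> * real z" using \<nu> z by simp
  show eq: "emeasure (distr ?P borel ?f) {t<..} = emeasure (rGTL \<alpha> (\<nu> * real z)) {t<..}" for t
  proof -
    have "?f -` {t<..} \<inter> space ?P = {y\<in>space ?P. \<forall>i\<in>{1..z}. y i \<in> {t<..}}"
      using z by auto
    then have "emeasure (distr ?P borel ?f) {t<..} = emeasure ?P {y\<in>space ?P. \<forall>i\<in>{1..z}. y i \<in> {t<..}}"
      by (subst emeasure_distr[OF meas]) simp_all
    also have "\<dots> = (\<Prod>i\<in>{1..z}. emeasure (rGTL \<alpha> \<nu>) {t<..})"
      by (rule emeasure_PiM_Collect) auto
    also have "\<dots> = ennreal ((rGTL_base \<alpha> t powr \<nu>) ^ z)"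
      by (simp add: emeasure_rGTL_greaterThan[OF \<alpha> \<nu>] ennreal_power)
    also have "(rGTL_base \<alpha> t powr \<nu>) ^ z = rGTL_base \<alpha> t powr (\<nu> * real z)"
      \<comment> \<open>The base can be 0, where the two kinds of power agree only for z \<ge> 1:
        \<open>0 powr 0\<close> is 0, but \<open>0 ^ 0\<close> is 1.\<close>
      using z by (subst powr_realpow'[symmetric]) (simp_all add: powr_powr)
    also have "ennreal \<dots> = emeasure (rGTL \<alpha> (\<nu> * real z)) {t<..}"
      by (simp add: emeasure_rGTL_greaterThan[OF \<alpha> \<nu>z])
    finally show ?thesis .
  qed
  show "emeasure (distr ?P borel ?f) {t<..} < \<infinity>" for t
    unfolding eq by (simp add: emeasure_rGTL_greaterThan[OF \<alpha> \<nu>z])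
qed simp_all

lemma nn_integral_rGTL_PS:
  assumes \<alpha>: "0 < \<alpha>" "\<alpha> \<le> 2" and \<nu>: "0 < \<nu>" and [measurable]: "g \<in> borel_measurable borel"
  shows "(\<integral>\<^sup>+y. g y \<partial>rGTL_PS \<alpha> \<nu> a \<theta>) =
    (\<Sum>n. ennreal (PS_prob a \<theta> (Suc n)) * (\<integral>\<^sup>+y. g y \<partial>rGTL \<alpha> (\<nu> * real (Suc n))))"
proof -
  let ?P = "\<Pi>\<^sub>M i\<in>{1::nat..}. rGTL \<alpha> \<nu>"
  interpret P: prob_space ?P
    by (rule prob_space_PiM) (rule prob_space_rGTL[OF \<alpha> \<nu>])
  have min [measurable]: "(\<lambda>y. Min (y ` {1..z})) \<in> borel_measurable ?P" for z :: nat
    by (intro borel_measurable_Min) auto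
  have s: "sets (power_series_dist a \<theta>) = sets (count_space UNIV)"
    by (simp add: power_series_dist_def point_measure_def)
  \<comment> \<open>The first component ranges over a countable type, so joint measurability reduces
    to that of each section in y.\<close>
  have m [measurable]: "(\<lambda>(z, y). Min (y ` {1..z})) \<in> borel_measurable (power_series_dist a \<theta> \<Otimes>\<^sub>M ?P)"
    unfolding measurable_cong_sets[OF sets_pair_measure_cong[OF s refl] refl]
    by (intro measurable_pair_measure_countable1) auto
  have "(\<integral>\<^sup>+y. g y \<partial>rGTL_PS \<alpha> \<nu> a \<theta>) =
      (\<integral>\<^sup>+x. g ((\<lambda>(z, y). Min (y ` {1..z})) x) \<partial>(power_series_dist a \<theta> \<Otimes>\<^sub>M ?P))"
    unfolding rGTL_PS_def by (rule nn_integral_distr[OF m]) simp_all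
  also have "\<dots> = (\<integral>\<^sup>+z. \<integral>\<^sup>+y. g (Min (y ` {1..z})) \<partial>?P \<partial>power_series_dist a \<theta>)"
    by (subst P.nn_integral_fst[symmetric]) (rule measurable_compose[OF m], simp_all)
  also have "\<dots> = (\<Sum>z. ennreal (PS_prob a \<theta> z) * (\<integral>\<^sup>+y. g (Min (y ` {1..z})) \<partial>?P))"
    unfolding power_series_dist_def point_measure_def
    by (subst nn_integral_density) (simp_all add: nn_integral_count_space_nat)
  \<comment> \<open>The term at z = 0, where \<open>Min\<close> is taken of the empty set, has
    weight 0.\<close>
  also have "\<dots> = (\<Sum>n. ennreal (PS_prob a \<theta> (Suc n)) * (\<integral>\<^sup>+y. g (Min (y ` {1..Suc n})) \<partial>?P))"
    by (subst suminf_offset[where i = 1]) (simp_all add: PS_prob_def)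
  also have "\<dots> = (\<Sum>n. ennreal (PS_prob a \<theta> (Suc n)) * (\<integral>\<^sup>+y. g y \<partial>rGTL \<alpha> (\<nu> * real (Suc n))))"
  proof (intro suminf_cong arg_cong2[where f = "(*)"] refl)
    fix n
    show "(\<integral>\<^sup>+y. g (Min (y ` {1..Suc n})) \<partial>?P) = (\<integral>\<^sup>+y. g y \<partial>rGTL \<alpha> (\<nu> * real (Suc n)))"
      by (subst distr_Min_rGTL[OF \<alpha> \<nu>, of "Suc n", symmetric], simp,
          subst nn_integral_distr[OF min]) simp_all
  qed
  finally show ?thesis .
qed

section \<open>Beta integrals for the moments\<close>

text \<open>The closed form of the integral of y^r (1 - y)^(s - 1) (\<alpha> - 2 (\<alpha> - 1)(1 -
  y)) over [0, 1]; the h-th moment term uses it at s + h.\<close>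

definition moment_weight :: "real \<Rightarrow> nat \<Rightarrow> real \<Rightarrow> real" where
  "moment_weight \<alpha> r s =
     ((2 - \<alpha>) + 2 * (\<alpha> - 1) * (real r + 1) / (s + real r + 1)) * Beta (real r + 1) s"

lemma moment_term_eq:
  "moment_term \<alpha> r s h =
     (- ((\<alpha> - 1) / \<alpha>)) ^ h * (rGamma (s - real h) / fact h) * moment_weight \<alpha> r (s + real h)"
  by (simp add: moment_term_def moment_weight_def Let_def)

lemma Beta_real_pos: "0 < x \<Longrightarrow> 0 < y \<Longrightarrow> 0 < Beta x (y :: real)"
  by (simp add: Beta_def Gamma_real_pos)

lemma not_nonpos_Ints_pos: "0 < (x::real) \<Longrightarrow> x \<notin> \<int>\<^sub>\<le>\<^sub>0"
  by (auto elim!: nonpos_Ints_cases)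

lemma has_bochner_integral_Beta:
  assumes "1 \<le> r" "0 < s"
  shows "has_bochner_integral lborel (\<lambda>y. indicator {0..1} y * (y ^ r * (1 - y) powr (s - 1)))
    (Beta (real r + 1) s)"
proof (rule has_bochner_integral_nn_integral)
  have "((\<lambda>t. t powr real r * (1 - t) powr (s - 1)) has_integral Beta (real r + 1) s) {0..1}"
    using has_integral_Beta_real[of "real r + 1" s] assms by simp
  also have "?this \<longleftrightarrow> ((\<lambda>t. t ^ r * (1 - t) powr (s - 1)) has_integral Beta (real r + 1) s) {0..1}"
    \<comment> \<open>At t = 0 the real and the natural power agree because r \<ge> 1.\<close>
    using assms by (intro has_integral_cong) (simp add: powr_realpow')
  also have "\<dots> \<longleftrightarrow> ((\<lambda>y. indicator {0..1} y * (y ^ r * (1 - y) powr (s - 1)))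
      has_integral Beta (real r + 1) s) UNIV"
    by (subst has_integral_restrict_UNIV[symmetric], intro has_integral_cong) simp
  finally show "(\<integral>\<^sup>+y. ennreal (indicator {0..1} y * (y ^ r * (1 - y) powr (s - 1))) \<partial>lborel)
      = ennreal (Beta (real r + 1) s)"
    by (intro nn_integral_has_integral_lborel) (auto simp: indicator_def)
qed (use assms Beta_real_pos[of "real r + 1" s] in \<open>auto simp: indicator_def less_imp_le\<close>)

text \<open>Splitting the last factor gives Beta integrals at s and s + 1. The recurrence B(r + 1, s
  + 1) = s / (s + r + 1) B(r + 1, s), with s written as (s + r + 1) - (r + 1), produces the bracket
  of the formula.\<close>

lemma has_bochner_integral_moment_weight:
  assumes "1 \<le> r" "0 < s"
  shows "has_bochner_integral lborel
    (\<lambda>y. indicator {0..1} y * (y ^ r * (1 - y) powr (s - 1) * (\<alpha> - 2 * (\<alpha> - 1) * (1 - y))))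
    (moment_weight \<alpha> r s)"
proof -
  let ?f = "\<lambda>s y. indicator {0..1} y * (y ^ r * (1 - y) powr (s - 1)) :: real"
  have "has_bochner_integral lborel (\<lambda>y. \<alpha> * ?f s y - 2 * (\<alpha> - 1) * ?f (s + 1) y)
      (\<alpha> * Beta (real r + 1) s - 2 * (\<alpha> - 1) * Beta (real r + 1) (s + 1))"
    using assms by (intro has_bochner_integral_diff has_bochner_integral_mult_right
        has_bochner_integral_Beta) auto
  moreover have "\<alpha> * ?f s y - 2 * (\<alpha> - 1) * ?f (s + 1) y =
      indicator {0..1} y * (y ^ r * (1 - y) powr (s - 1) * (\<alpha> - 2 * (\<alpha> - 1) * (1 - y)))" for y
  proof (cases "y \<in> {0..1}")
    case True
    then have ind: "indicator {0..1} y = (1 :: real)"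
      and pw: "(1 - y) powr (s + 1 - 1) = (1 - y) * (1 - y) powr (s - 1)"
      using powr_mult_base[of "1 - y" "s - 1"] by simp_all
    have "\<alpha> * (Y * P) - 2 * (\<alpha> - 1) * (Y * (U * P)) = Y * P * (\<alpha> - 2 * (\<alpha> - 1) * U)"
      for Y P U :: real by (simp add: algebra_simps)
    then show ?thesis unfolding ind pw mult_1 .
  qed simp
  moreover have "\<alpha> * Beta (real r + 1) s - 2 * (\<alpha> - 1) * Beta (real r + 1) (s + 1) = moment_weight \<alpha> r s"
    using Beta_plus1_right[OF not_nonpos_Ints_pos[OF assms(2)], of "real r + 1"] assms
    by (simp add: moment_weight_def divide_simps) algebra
  ultimately show ?thesis by simp
qed

text \<open>Read off from the integral, since in the closed form a summand is negative for \<alpha>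
  < 1. It lets absolute values pass through termwise integration.\<close>

lemma moment_weight_nonneg:
  assumes "1 \<le> r" "0 < s" "0 < \<alpha>" "\<alpha> \<le> 2"
  shows "0 \<le> moment_weight \<alpha> r s"
  unfolding has_bochner_integral_integral_eq[OF has_bochner_integral_moment_weight[OF assms(1,2)], symmetric]
  using affine_unit_nonneg[OF assms(3,4)]
  by (intro integral_nonneg_AE AE_I2) (auto simp: indicator_def)

section \<open>Convergence of the inner series\<close>

text \<open>For r = 1 the value is 1 / (x (x + 1)), and raising r by 1 multiplies it by (r + 1) / (r
  + 1 + x) \<le> 1.\<close>

lemma Beta_le_inverse_square:
  assumes "1 \<le> r" "0 < x"
  shows "Beta (real r + 1) x \<le> 1 / x\<^sup>2"
  using assms(1)
proof (induction r rule: nat_induct_at_least)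
  case base
  have "Beta 1 x = 1 / x"
    using assms(2) Gamma_plus1[OF not_nonpos_Ints_pos[OF assms(2)]]
      less_imp_neq[OF Gamma_real_pos[OF assms(2)]]
    by (simp add: Beta_def add.commute)
  moreover have "(1 + x) * Beta 2 x = Beta 1 x"
    using Beta_plus1_left[of 1 x] by (simp add: not_nonpos_Ints_pos)
  ultimately have "(1 + x) * Beta 2 x = 1 / x" by simp
  then have "Beta 2 x = 1 / x / (1 + x)"
    using assms(2) by (simp add: nonzero_eq_divide_eq mult.commute mult.left_commute)
  then show ?case using assms(2) by (simp add: power2_eq_square frac_le)
next
  case (Suc r)
  have "(real r + 1 + x) * Beta (real r + 1 + 1) x = (real r + 1) * Beta (real r + 1) x"
    by (rule Beta_plus1_left) (simp add: not_nonpos_Ints_pos)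
  then have "Beta (real r + 1 + 1) x = (real r + 1) / (real r + 1 + x) * Beta (real r + 1) x"
    using assms(2) by (simp add: field_simps)
  also have "\<dots> \<le> 1 * Beta (real r + 1) x"
    using assms(2) Beta_real_pos[of "real r + 1" x] by (intro mult_right_mono) auto
  finally show ?case using Suc.IH by (simp add: add.commute)
qed

text \<open>The recurrence behind all ratios of successive terms; for \<open>rGamma\<close> it holds
  at the poles of Gamma as well.\<close>

lemma rGamma_diff_Suc: "rGamma (s - real (Suc h)) = (s - real h - 1) * rGamma (s - real h)"
  using rGamma_plus1[of "s - real h - 1"] by (simp add: algebra_simps)

lemma abs_diff_one_divide_le_1:
  fixes \<alpha> :: real
  assumes "1/2 \<le> \<alpha>"
  shows "\<bar>(\<alpha> - 1) / \<alpha>\<bar> \<le> 1"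
proof -
  have "0 < \<alpha>" "\<bar>\<alpha> - 1\<bar> \<le> \<alpha>" using assms by linarith+
  then show ?thesis by (simp only: abs_divide divide_le_eq_1_pos abs_of_pos)
qed

text \<open>Powers of k are bounded by 1, the quotients of \<open>rGamma\<close> by factorials stop
  growing in absolute value, and the weights are O(1/h^2).\<close>

lemma summable_abs_moment_term_ge_half:
  assumes \<alpha>: "1/2 \<le> \<alpha>" "\<alpha> \<le> 2" and s: "0 < s" and r: "1 \<le> r"
  shows "summable (\<lambda>h. \<bar>moment_term \<alpha> r s h\<bar>)"
proof -
  define q where "q h = \<bar>rGamma (s - real h) / fact h\<bar>" for h :: nat
  \<comment> \<open>From h \<ge> N > s on, |s - h - 1| = h + 1 - s \<le> h + 1, so the ratio of
    successive values of \<open>q\<close> is at most 1.\<close>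
  obtain N :: nat where N: "s < real N" using reals_Archimedean2 by blast
  have q: "q h \<le> q N" if "N \<le> h" for h
    using that
  proof (induction h rule: dec_induct)
    case (step h)
    have "rGamma (s - real (Suc h)) / fact (Suc h) =
        rGamma (s - real h) / fact h * ((s - real h - 1) / (real h + 1))"
      unfolding rGamma_diff_Suc by (simp add: divide_simps)
    then have "q (Suc h) = q h * (\<bar>s - real h - 1\<bar> / (real h + 1))"
      unfolding q_def by (simp only: abs_mult) simp
    also have "\<dots> \<le> q h * 1"
      using step N s by (intro mult_left_mono) (auto simp: q_def)
    finally show ?case using step.IH by simp
  qed simp
  have q_nonneg: "0 \<le> q h" for h by (simp add: q_def)
  have k: "\<bar>(- ((\<alpha> - 1) / \<alpha>)) ^ h\<bar> \<le> 1" for h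
  proof -
    have "\<bar>- ((\<alpha> - 1) / \<alpha>)\<bar> \<le> 1"
      using abs_diff_one_divide_le_1[OF \<alpha>(1)] by (simp only: abs_minus_cancel)
    then show ?thesis unfolding power_abs by (rule power_le_one[OF abs_ge_zero])
  qed
  \<comment> \<open>The bracket is at most |2 - \<alpha>| + |2 (\<alpha> - 1)| \<le> 4; the constant
    6 is a generous bound.\<close>
  have w: "\<bar>moment_weight \<alpha> r (s + real h)\<bar> \<le> 6 * (1 / (s + real h)\<^sup>2)" for h
  proof -
    have "\<bar>(2 - \<alpha>) + 2 * (\<alpha> - 1) * (real r + 1) / (s + real h + real r + 1)\<bar> \<le>
        \<bar>2 - \<alpha>\<bar> + \<bar>2 * (\<alpha> - 1)\<bar> * ((real r + 1) / (s + real h + real r + 1))"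
      using s by (intro order_trans[OF abs_triangle_ineq]) (simp add: abs_mult)
    also have "\<dots> \<le> \<bar>2 - \<alpha>\<bar> + \<bar>2 * (\<alpha> - 1)\<bar> * 1"
      using s by (intro add_left_mono mult_left_mono) simp_all
    also have "\<dots> \<le> 6"
    proof -
      have a: "\<bar>2 - \<alpha>\<bar> \<le> 2"
        by (rule abs_leI) (use \<alpha> in linarith)+
      have b: "\<bar>2 * \<alpha> - 2\<bar> \<le> 2"
        by (rule abs_leI) (use \<alpha> in linarith)+
      have c: "2 * (\<alpha> - 1) = 2 * \<alpha> - 2"
        by (rule right_diff_distrib[of 2 \<alpha> 1, unfolded mult_1_right])
      have "x + y * 1 \<le> 6" if "x \<le> 2" "y \<le> 2" for x y :: real
        using that by linarith
      from this[OF a b] show ?thesis unfolding c .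
    qed
    finally show ?thesis
      unfolding moment_weight_def abs_mult
      using Beta_le_inverse_square[OF r, of "s + real h"] Beta_real_pos[of "real r + 1" "s + real h"] s
      by (intro mult_mono) (simp_all del: of_nat_Suc)
  qed
  have sq: "summable (\<lambda>h. q N * 6 * inverse ((real h)\<^sup>2))"
    by (intro summable_mult inverse_power_summable) simp
  \<comment> \<open>The majorant is 0 at h = 0, as \<open>inverse 0\<close> is 0, so the comparison
    starts at 1 or later.\<close>
  have bd: "\<bar>moment_term \<alpha> r s h\<bar> \<le> q N * 6 * inverse ((real h)\<^sup>2)" if "max 1 N \<le> h" for h
  proof -
    have h: "0 < real h" "N \<le> h" using that by simp_all
    have "\<bar>moment_term \<alpha> r s h\<bar> = \<bar>(- ((\<alpha> - 1) / \<alpha>)) ^ h\<bar> * q h * \<bar>moment_weight \<alpha> r (s + real h)\<bar>"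
      unfolding moment_term_eq abs_mult q_def ..
    also have "\<dots> \<le> 1 * q N * (6 * (1 / (s + real h)\<^sup>2))"
      by (rule mult_mono[OF mult_mono[OF k q[OF h(2)] _ q_nonneg] w]) (simp_all add: q_nonneg)
    also have "\<dots> \<le> 1 * q N * (6 * (1 / (real h)\<^sup>2))"
    proof (rule mult_left_mono)
      have "1 / (s + real h)\<^sup>2 \<le> 1 / (real h)\<^sup>2"
        using h(1) s by (intro divide_left_mono power_mono mult_pos_pos zero_less_power) simp_all
      then show "6 * (1 / (s + real h)\<^sup>2) \<le> 6 * (1 / (real h)\<^sup>2)" by (rule mult_left_mono) simp
    qed (simp add: q_nonneg)
    finally show ?thesis by (simp add: divide_inverse)
  qed
  show ?thesis
  proof (rule summable_comparison_test'[OF sq])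
    show "norm \<bar>moment_term \<alpha> r s h\<bar> \<le> q N * 6 * inverse ((real h)\<^sup>2)" if "max 1 N \<le> h" for h
      unfolding real_norm_def abs_idempotent by (rule bd[OF that])
  qed
qed

text \<open>For s outside the naturals no value \<open>rGamma (s - h)\<close> vanishes, so the late
  terms are nonzero. Their successive ratios tend to |k| > 1 in absolute value, so they cannot tend
  to 0.\<close>

lemma summable_moment_term_imp_Nats:
  assumes \<alpha>: "0 < \<alpha>" "\<alpha> < 1/2" and s: "0 < s" and sm: "summable (moment_term \<alpha> r s)"
  shows "s \<in> \<nat>"
proof (rule ccontr)
  assume s_nat: "s \<notin> \<nat>"
  define b where "b h = (2 - \<alpha>) + 2 * (\<alpha> - 1) * (real r + 1) / (s + real h + real r + 1)" for h
  define \<kappa> where "\<kappa> = (1 - \<alpha>) / \<alpha>"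
  \<comment> \<open>The ratio of successive terms: its factors come from the power of -k, from
    \<open>rGamma\<close> over the factorial, from the Beta function and from the bracket. They tend
    to \<kappa>, -1, 1 and 1.\<close>
  define \<rho> where "\<rho> h = \<kappa> * ((s - real h - 1) / (real h + 1)) *
    ((s + real h) / (s + real h + real r + 1)) * (b (Suc h) / b h)" for h
  have \<kappa>: "1 < \<kappa>" using \<alpha> by (simp add: \<kappa>_def field_simps)
  have b_lim: "b \<longlonglongrightarrow> 2 - \<alpha>"
  proof -
    have "(\<lambda>h. 1 / (s + real h + real r + 1)) \<longlonglongrightarrow> 0" by real_asymp
    from tendsto_add[OF tendsto_const tendsto_mult[OF tendsto_const this]]
    have "(\<lambda>h. (2 - \<alpha>) + 2 * (\<alpha> - 1) * (real r + 1) * (1 / (s + real h + real r + 1)))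
        \<longlonglongrightarrow> (2 - \<alpha>) + 2 * (\<alpha> - 1) * (real r + 1) * 0" .
    then show ?thesis unfolding b_def[abs_def] by simp
  qed
  have "(\<lambda>h. b (Suc h) / b h) \<longlonglongrightarrow> (2 - \<alpha>) / (2 - \<alpha>)"
    using \<alpha> by (intro tendsto_divide LIMSEQ_Suc b_lim) auto
  moreover have "(\<lambda>h. (s - real h - 1) / (real h + 1)) \<longlonglongrightarrow> -1" by real_asymp
  moreover have "(\<lambda>h. (s + real h) / (s + real h + real r + 1)) \<longlonglongrightarrow> 1" by real_asymp
  ultimately have "\<rho> \<longlonglongrightarrow> \<kappa> * (-1) * 1 * ((2 - \<alpha>) / (2 - \<alpha>))"
    unfolding \<rho>_def[abs_def] by (intro tendsto_mult tendsto_const)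
  then have "(\<lambda>h. \<bar>\<rho> h\<bar>) \<longlonglongrightarrow> \<bar>\<kappa> * (-1) * 1 * ((2 - \<alpha>) / (2 - \<alpha>))\<bar>"
    by (rule tendsto_rabs)
  then have "(\<lambda>h. \<bar>\<rho> h\<bar>) \<longlonglongrightarrow> \<kappa>" using \<alpha> \<kappa> by simp
  then have "eventually (\<lambda>h. 1 < \<bar>\<rho> h\<bar>) sequentially"
    using \<kappa> by (rule order_tendstoD)
  moreover have "eventually (\<lambda>h. 0 < b h) sequentially"
    by (rule order_tendstoD(1)[OF b_lim]) (use \<alpha> in simp)
  ultimately have "eventually (\<lambda>h. 1 < \<bar>\<rho> h\<bar> \<and> 0 < b h) sequentially"
    by eventually_elim simp
  then obtain N where N: "\<And>h. N \<le> h \<Longrightarrow> 1 < \<bar>\<rho> h\<bar>" "\<And>h. N \<le> h \<Longrightarrow> 0 < b h"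
    unfolding eventually_sequentially by blast
  have t: "moment_term \<alpha> r s h =
      \<kappa> ^ h * (rGamma (s - real h) / fact h) * (b h * Beta (real r + 1) (s + real h))" for h
    by (simp add: moment_term_eq moment_weight_def b_def \<kappa>_def minus_divide_left)
  have moment_term_Suc: "moment_term \<alpha> r s (Suc h) = moment_term \<alpha> r s h * \<rho> h" if "N \<le> h" for h
  proof -
    have Beta_Suc: "Beta (real r + 1) (s + real (Suc h)) =
        Beta (real r + 1) (s + real h) * ((s + real h) / (s + real h + real r + 1))"
      using Beta_plus1_right[of "s + real h" "real r + 1"] s
      by (simp add: not_nonpos_Ints_pos field_simps)
    define c where "c = b (Suc h) / b h"
    have c: "b (Suc h) = b h * c" using N(2)[OF that] by (simp add: c_def)
    show ?thesis
      unfolding t[of "Suc h"] t[of h] \<rho>_def rGamma_diff_Suc Beta_Suc c_def[symmetric] c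
      by (simp add: ac_simps)
  qed
  have ge: "\<bar>moment_term \<alpha> r s N\<bar> \<le> \<bar>moment_term \<alpha> r s h\<bar>" if "N \<le> h" for h
    using that
  proof (induction h rule: dec_induct)
    case (step h)
    have "\<bar>moment_term \<alpha> r s h\<bar> * 1 \<le> \<bar>moment_term \<alpha> r s h\<bar> * \<bar>\<rho> h\<bar>"
      using N(1)[of h] step by (intro mult_left_mono) auto
    then show ?case using step moment_term_Suc[of h] by (simp add: abs_mult)
  qed simp
  have "(\<lambda>h. \<bar>moment_term \<alpha> r s h\<bar>) \<longlonglongrightarrow> 0"
    using tendsto_rabs[OF summable_LIMSEQ_zero[OF sm]] by simp
  then have "\<bar>moment_term \<alpha> r s N\<bar> \<le> 0"
    by (rule tendsto_lowerbound) (use ge in \<open>auto simp: eventually_sequentially\<close>)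
  then have "moment_term \<alpha> r s N = 0" by simp
  moreover have "rGamma (s - real N) \<noteq> 0"
  proof
    assume "rGamma (s - real N) = 0"
    then obtain n where "s - real N = - real n"
      by (auto simp: rGamma_eq_zero_iff elim!: nonpos_Ints_cases')
    then have "s = real N - real n" by simp
    \<comment> \<open>Since s > 0, N exceeds n and the natural subtraction does not
      truncate.\<close>
    with s have "s = real (N - n)" by (simp add: of_nat_diff)
    with s_nat show False by simp
  qed
  ultimately show False
    using N(2)[of N] \<kappa> Beta_real_pos[of "real r + 1" "s + real N"] s by (simp add: t)
qed

section \<open>Binomial expansion and termwise integration\<close>

text \<open>The convention 1/\<Gamma> = 0 at nonpositive integers truncates the inner series when s
  is a natural number.\<close>

lemma moment_term_eq_0:
  assumes "s = real n" "n \<le> h"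
  shows "moment_term \<alpha> r s h = 0"
proof -
  have "s - real h = - real (h - n)" using assms by (simp add: of_nat_diff)
  then have "rGamma (s - real h) = 0" by (simp add: rGamma_eq_zero_iff)
  then show ?thesis by (simp add: moment_term_eq)
qed

text \<open>The exponent s - 1 is a natural number, so this is the finite binomial theorem; unlike
  the general series it also covers |x| \<ge> 1.\<close>

lemma binomial_series_Nats:
  fixes s x :: real
  assumes "s \<in> \<nat>" "0 < s" "0 < 1 + x"
  shows "(\<lambda>h. ((s - 1) gchoose h) * x ^ h) sums (1 + x) powr (s - 1)"
proof -
  obtain m where m: "s - 1 = real m"
    using assms by (auto elim!: Nats_cases) (metis Suc_pred of_nat_Suc add_diff_cancel_left')
  have "(\<lambda>h. (real m gchoose h) * x ^ h) sums (\<Sum>h\<le>m. (real m gchoose h) * x ^ h)"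
    by (rule sums_finite) (auto simp: binomial_gbinomial[symmetric])
  also have "(\<Sum>h\<le>m. (real m gchoose h) * x ^ h) = (x + 1) ^ m"
    by (simp add: binomial_ring binomial_gbinomial)
  finally show ?thesis using assms(3) by (simp add: m powr_realpow add.commute)
qed

text \<open>The step common to both ranges of \<alpha>: summable integrals of the absolute values
  allow the sum and the integral to be exchanged.\<close>

lemma rGTL_moment:
  assumes \<alpha>: "0 < \<alpha>" "\<alpha> \<le> 2" and s: "0 < s" and r: "1 \<le> r"
    and summ: "summable (\<lambda>h. \<bar>moment_term \<alpha> r s h\<bar>)"
    and series: "\<And>u. 0 < u \<Longrightarrow> u < 1 \<Longrightarrow>
      (\<lambda>h. ((s - 1) gchoose h) * (- ((\<alpha> - 1) / \<alpha>) * u) ^ h) sums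
        (1 - (\<alpha> - 1) / \<alpha> * u) powr (s - 1)"
  shows "(\<integral>y. y ^ r \<partial>rGTL \<alpha> s) = \<alpha> powr (s - 1) * Gamma (s + 1) * (\<Sum>h. moment_term \<alpha> r s h)"
proof -
  define k where "k = (\<alpha> - 1) / \<alpha>"
  \<comment> \<open>From (\<alpha> - (\<alpha> - 1) u)^(s - 1) = \<alpha>^(s - 1) (1 - k u)^(s - 1):
    \<open>c\<close> collects the constants of the h-th binomial term, while its power u^h goes into
    \<open>w\<close>.\<close>
  define c where "c h = s * \<alpha> powr (s - 1) * (((s - 1) gchoose h) * (- k) ^ h)" for h
  define w where "w h y = indicator {0..1} y *
    (y ^ r * (1 - y) powr (s + real h - 1) * (\<alpha> - 2 * (\<alpha> - 1) * (1 - y)))" for h :: nat and y :: real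
  have w: "has_bochner_integral lborel (w h) (moment_weight \<alpha> r (s + real h))" for h
    unfolding w_def using has_bochner_integral_moment_weight[OF r, of "s + real h"] s by simp
  have w_nonneg: "0 \<le> w h y" for h y
    using affine_unit_nonneg[OF \<alpha>, of "1 - y"] by (auto simp: w_def indicator_def)
  \<comment> \<open>The binomial coefficient is \<Gamma>(s) / (\<Gamma>(s - h) h!), and the factor s
    of the density turns \<Gamma>(s) into \<Gamma>(s + 1).\<close>
  have c_eq: "c h * moment_weight \<alpha> r (s + real h) =
      \<alpha> powr (s - 1) * Gamma (s + 1) * moment_term \<alpha> r s h" for h
  proof -
    have "((s - 1) gchoose h) = Gamma s * (rGamma (s - real h) / fact h)"
      using s gbinomial_Gamma[of "s - 1" h]
      by (simp add: not_nonpos_Ints_pos rGamma_inverse_Gamma divide_inverse)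
    moreover have "Gamma (s + 1) = s * Gamma s"
      using s by (simp add: not_nonpos_Ints_pos Gamma_plus1)
    ultimately show ?thesis by (simp add: c_def k_def moment_term_eq)
  qed
  have int: "integrable lborel (\<lambda>y. c h * w h y)" for h
    using w by (intro integrable_mult_right) (auto simp: has_bochner_integral_iff)
  have int_eq: "(\<integral>y. c h * w h y \<partial>lborel) = \<alpha> powr (s - 1) * Gamma (s + 1) * moment_term \<alpha> r s h" for h
    using w[of h] by (simp add: has_bochner_integral_iff c_eq)
  have "(\<integral>y. norm (c h * w h y) \<partial>lborel) = \<bar>c h\<bar> * moment_weight \<alpha> r (s + real h)" for h
    using w[of h] w_nonneg by (simp add: has_bochner_integral_iff abs_mult)
  also have "\<bar>c h\<bar> * moment_weight \<alpha> r (s + real h) = \<bar>c h * moment_weight \<alpha> r (s + real h)\<bar>" for h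
    using moment_weight_nonneg[OF r _ \<alpha>, of "s + real h"] s by (simp add: abs_mult)
  finally have norm_int: "summable (\<lambda>h. \<integral>y. norm (c h * w h y) \<partial>lborel)"
    using summable_mult[OF summ, of "\<bar>\<alpha> powr (s - 1) * Gamma (s + 1)\<bar>"]
    by (simp add: c_eq abs_mult)
  define g where "g y = y ^ r * (rGTL_density \<alpha> s y * indicator {0..1} y)" for y
  \<comment> \<open>Absolute convergence at \<open>u\<close> comes from convergence at \<open>(1 + u) / 2 > u\<close>; this also covers \<open>\<bar>k\<bar> > 1\<close>.\<close>
  have ptw: "summable (\<lambda>h. norm (c h * w h y)) \<and> (\<lambda>h. c h * w h y) sums g y"
    if "y \<noteq> 0" "y \<noteq> 1" for y
  proof (cases "y \<in> {0<..<1}")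
    case True
    define u where "u = 1 - y"
    have u: "0 < u" "u < 1" using True by (auto simp: u_def)
    define d where "d = s * \<alpha> powr (s - 1) * y ^ r * u powr (s - 1) * (\<alpha> - 2 * (\<alpha> - 1) * u)"
    have cw: "c h * w h y = d * ((((s - 1) gchoose h) * (- k) ^ h) * u ^ h)" for h
    proof -
      have "u powr (s + real h - 1) = u powr (s - 1) * u ^ h"
        using u by (simp add: powr_realpow[symmetric] powr_add[symmetric] algebra_simps)
      then show ?thesis
        using True unfolding c_def w_def d_def u_def[symmetric] by simp
    qed
    have "summable (\<lambda>h. (((s - 1) gchoose h) * (- k) ^ h) * ((1 + u) / 2) ^ h)"
      using sums_summable[OF series[of "(1 + u) / 2"]] u
      by (simp only: k_def[symmetric] power_mult_distrib mult.assoc) simp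
    then have "summable (\<lambda>h. norm ((((s - 1) gchoose h) * (- k) ^ h) * u ^ h))"
      by (rule powser_insidea) (use u in auto)
    then have "summable (\<lambda>h. norm (c h * w h y))"
      unfolding cw norm_mult[of d] by (rule summable_mult)
    moreover have "(\<lambda>h. c h * w h y) sums (d * (1 - k * u) powr (s - 1))"
      unfolding cw using sums_mult[OF series[OF u], of d]
      by (simp only: k_def[symmetric] power_mult_distrib mult.assoc)
    moreover have "d * (1 - k * u) powr (s - 1) = g y"
    proof -
      have "\<alpha> * (1 - k * u) = \<alpha> - (\<alpha> - 1) * u" using \<alpha> by (simp add: k_def field_simps)
      then have "\<alpha> powr (s - 1) * (1 - k * u) powr (s - 1) = (\<alpha> - (\<alpha> - 1) * u) powr (s - 1)"
        by (metis powr_mult)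
      then show ?thesis
        using True unfolding g_def d_def rGTL_density_def u_def[symmetric] by simp
    qed
    ultimately show ?thesis by simp
  next
    case False
    then have "w h y = 0" "g y = 0" for h using that by (auto simp: w_def g_def)
    then show ?thesis by simp
  qed
  have "AE y in lborel. y \<noteq> 0 \<and> y \<noteq> (1::real)"
    using AE_lborel_singleton[of "0::real"] AE_lborel_singleton[of "1::real"] by eventually_elim simp
  then have ae: "AE y in lborel. summable (\<lambda>h. norm (c h * w h y)) \<and> g y = (\<Sum>h. c h * w h y)"
    by eventually_elim (blast intro: ptw[THEN conjunct1] sums_unique ptw[THEN conjunct2])
  have ae1: "AE y in lborel. summable (\<lambda>h. norm (c h * w h y))"
    using ae by eventually_elim simp
  have ae2: "AE y in lborel. g y = (\<Sum>h. c h * w h y)"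
    using ae by eventually_elim simp
  have [measurable]: "w h \<in> borel_measurable borel" for h
    unfolding w_def by measurable
  have [measurable]: "g \<in> borel_measurable borel"
    unfolding g_def by measurable
  have "(\<integral>y. y ^ r \<partial>rGTL \<alpha> s) =
      (\<integral>y. (rGTL_density \<alpha> s y * indicator {0..1} y) *\<^sub>R y ^ r \<partial>lborel)"
    unfolding rGTL_def
    by (rule integral_density) (simp_all add: indicator_def rGTL_density_nonneg[OF \<alpha> s])
  also have "\<dots> = (\<integral>y. g y \<partial>lborel)"
    by (simp add: g_def mult.commute)
  also have "\<dots> = (\<integral>y. (\<Sum>h. c h * w h y) \<partial>lborel)"
    by (rule integral_cong_AE[OF _ _ ae2]) measurable
  also have "\<dots> = (\<Sum>h. \<integral>y. c h * w h y \<partial>lborel)"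
    by (rule integral_suminf[OF int ae1 norm_int])
  also have "\<dots> = \<alpha> powr (s - 1) * Gamma (s + 1) * (\<Sum>h. moment_term \<alpha> r s h)"
    unfolding int_eq by (rule suminf_mult) (use summ in \<open>rule summable_rabs_cancel\<close>)
  finally show ?thesis .
qed

text \<open>Below 1/2 the assumed convergence makes s a natural number and all sums finite; from 1/2
  on, |k| \<le> 1 and u < 1 put k u inside the disc of the general binomial series.\<close>

lemma rGTL_moment_series:
  assumes \<alpha>: "0 < \<alpha>" "\<alpha> \<le> 2" and s: "0 < s" and r: "1 \<le> r"
    and sm: "\<alpha> < 1/2 \<Longrightarrow> summable (moment_term \<alpha> r s)"
  shows "summable (moment_term \<alpha> r s)"
    and "(\<integral>y. y ^ r \<partial>rGTL \<alpha> s) = \<alpha> powr (s - 1) * Gamma (s + 1) * (\<Sum>h. moment_term \<alpha> r s h)"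
proof -
  let ?k = "(\<alpha> - 1) / \<alpha>"
  \<comment> \<open>The base is (\<alpha> - (\<alpha> - 1) u) / \<alpha>.\<close>
  have pos: "0 < 1 + - ?k * u" if "0 < u" "u < 1" for u
    using affine_unit_pos[of \<alpha> u] \<alpha> that by (simp add: field_simps)
  have *: "summable (\<lambda>h. \<bar>moment_term \<alpha> r s h\<bar>) \<and> (\<forall>u. 0 < u \<longrightarrow> u < 1 \<longrightarrow>
      (\<lambda>h. ((s - 1) gchoose h) * (- ?k * u) ^ h) sums (1 + - ?k * u) powr (s - 1))"
  proof (cases "\<alpha> < 1/2")
    case True
    have nat: "s \<in> \<nat>"
      using summable_moment_term_imp_Nats[OF \<alpha>(1) True s sm[OF True]] .
    then obtain n where "s = real n" by (auto elim: Nats_cases)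
    then have "summable (\<lambda>h. \<bar>moment_term \<alpha> r s h\<bar>)"
      by (intro summable_finite[of "{..<n}"]) (auto simp: moment_term_eq_0)
    then show ?thesis using binomial_series_Nats[OF nat s pos] by blast
  next
    case False
    have "\<bar>- ?k * u\<bar> < 1" if "0 < u" "u < 1" for u
    proof -
      have "\<bar>?k\<bar> \<le> 1" by (rule abs_diff_one_divide_le_1) (use False in simp)
      then have "\<bar>?k\<bar> * u \<le> 1 * u" using that by (intro mult_right_mono) auto
      then show ?thesis using that by (simp add: abs_mult)
    qed
    then have "(\<lambda>h. ((s - 1) gchoose h) * (- ?k * u) ^ h) sums (1 + - ?k * u) powr (s - 1)"
      if "0 < u" "u < 1" for u
      using that by (blast intro: gen_binomial_real)
    moreover have "summable (\<lambda>h. \<bar>moment_term \<alpha> r s h\<bar>)"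
      by (rule summable_abs_moment_term_ge_half[OF _ \<alpha>(2) s r]) (use False in simp)
    ultimately show ?thesis by blast
  qed
  then show "summable (moment_term \<alpha> r s)" by (blast intro: summable_rabs_cancel)
  show "(\<integral>y. y ^ r \<partial>rGTL \<alpha> s) = \<alpha> powr (s - 1) * Gamma (s + 1) * (\<Sum>h. moment_term \<alpha> r s h)"
    using * by (intro rGTL_moment[OF \<alpha> s r]) auto
qed

section \<open>Moments of the mixture\<close>

theorem mainTheorem1:
  fixes M :: "'a measure" and Y :: "'a \<Rightarrow> real"
    and \<alpha> \<nu> \<theta> :: real and a :: "nat \<Rightarrow> real" and r :: nat
  assumes "0 < \<alpha>" and "\<alpha> \<le> 2" and "0 < \<nu>" and "0 < \<theta>"
    and "\<And>z. 1 \<le> z \<Longrightarrow> 0 \<le> a z"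
    and "summable (\<lambda>n. a (Suc n) * \<theta> ^ Suc n)"
    and "0 < PS_norm a \<theta>"
    and "1 \<le> r"
    and "prob_space M"
    and "Y \<in> borel_measurable M"
    and "distr M borel Y = rGTL_PS \<alpha> \<nu> a \<theta>"
    \<comment> \<open>For \<open>\<alpha> < 1/2\<close> we have \<open>\<bar>k\<bar> > 1\<close> and an inner series may diverge; then the right-hand side
        is meaningless. For \<open>\<alpha> \<ge> 1/2\<close> nothing is assumed and convergence is part of the claim.\<close>
    and "\<alpha> < 1 / 2 \<Longrightarrow> \<forall>z\<ge>1. a z \<noteq> 0 \<longrightarrow> summable (moment_term \<alpha> r (\<nu> * real z))"
  shows "integrable M (\<lambda>\<omega>. Y \<omega> ^ r)
    \<and> (\<forall>z\<ge>1. a z \<noteq> 0 \<longrightarrow> summable (moment_term \<alpha> r (\<nu> * real z)))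
    \<and> (\<lambda>n. let z = Suc n in
          a z * \<theta> ^ z / PS_norm a \<theta> * \<alpha> powr (\<nu> * real z - 1) * Gamma (\<nu> * real z + 1)
            * (\<Sum>h. moment_term \<alpha> r (\<nu> * real z) h))
        sums (\<integral>\<omega>. Y \<omega> ^ r \<partial>M)"
proof -
  note \<alpha> = assms(1,2) and \<nu> = assms(3) and Ymeas [measurable] = assms(10)
  have \<nu>z: "0 < \<nu> * real z" if "1 \<le> z" for z using \<nu> that by simp
  define p where "p n = PS_prob a \<theta> (Suc n)" for n
  define m where "m n = (\<integral>y. y ^ r \<partial>rGTL \<alpha> (\<nu> * real (Suc n)))" for n
  have p_nonneg: "0 \<le> p n" for n
    using assms(4,5,7) by (simp add: p_def PS_prob_def)
  have p_summable: "summable p"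
    using summable_divide[OF assms(6), of "PS_norm a \<theta>"] by (simp add: p_def[abs_def] PS_prob_def)
  have nnY: "(\<integral>\<^sup>+\<omega>. g (Y \<omega>) \<partial>M) =
      (\<Sum>n. ennreal (p n) * (\<integral>\<^sup>+y. g y \<partial>rGTL \<alpha> (\<nu> * real (Suc n))))"
    if g [measurable]: "g \<in> borel_measurable borel" for g :: "real \<Rightarrow> ennreal"
  proof -
    have "(\<integral>\<^sup>+\<omega>. g (Y \<omega>) \<partial>M) = (\<integral>\<^sup>+y. g y \<partial>distr M borel Y)"
      by (rule nn_integral_distr[symmetric]) simp_all
    then show ?thesis
      unfolding assms(11) nn_integral_rGTL_PS[OF \<alpha> \<nu> g] p_def .
  qed
  \<comment> \<open>The mixture formula is applied to the indicator of the complement of [0, 1], a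
    null set for every component.\<close>
  have AE_Y: "AE \<omega> in M. Y \<omega> \<in> {0..1}"
  proof -
    have "(\<integral>\<^sup>+y. indicator (- {0..1}) y \<partial>rGTL \<alpha> s) = 0" for s
    proof -
      have "AE y in rGTL \<alpha> s. indicator (- {0..1}) y = (0 :: ennreal)"
        using AE_rGTL by eventually_elim simp
      then have "(\<integral>\<^sup>+y. indicator (- {0..1}) y \<partial>rGTL \<alpha> s) = (\<integral>\<^sup>+y. 0 \<partial>rGTL \<alpha> s)"
        by (rule nn_integral_cong_AE)
      then show ?thesis by simp
    qed
    then have "(\<integral>\<^sup>+\<omega>. indicator (- {0..1}) (Y \<omega>) \<partial>M) = 0"
      by (simp add: nnY[of "indicator (- {0..1})"])
    then have "AE \<omega> in M. indicator (- {0..1}) (Y \<omega>) = (0 :: ennreal)"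
      by (subst (asm) nn_integral_0_iff_AE) simp_all
    then show ?thesis
      by eventually_elim (auto simp: indicator_def split: if_splits)
  qed
  have m: "(\<integral>\<^sup>+y. ennreal (y ^ r) \<partial>rGTL \<alpha> (\<nu> * real (Suc n))) = ennreal (m n)"
    and m01: "0 \<le> m n" "m n \<le> 1" for n
  proof -
    interpret prob_space "rGTL \<alpha> (\<nu> * real (Suc n))"
      using prob_space_rGTL[OF \<alpha> \<nu>z[of "Suc n"]] by simp
    have ae: "AE y in rGTL \<alpha> (\<nu> * real (Suc n)). 0 \<le> y ^ r \<and> y ^ r \<le> 1"
      using AE_rGTL by eventually_elim (auto simp: power_le_one)
    have int: "integrable (rGTL \<alpha> (\<nu> * real (Suc n))) (\<lambda>y. y ^ r)"
      by (rule integrable_const_bound[where B = 1]) (use ae in auto)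
    show "(\<integral>\<^sup>+y. ennreal (y ^ r) \<partial>rGTL \<alpha> (\<nu> * real (Suc n))) = ennreal (m n)"
      unfolding m_def by (rule nn_integral_eq_integral[OF int]) (use ae in auto)
    show "0 \<le> m n" unfolding m_def by (rule integral_nonneg_AE) (use ae in auto)
    show "m n \<le> 1" unfolding m_def by (rule integral_le_const[OF int]) (use ae in auto)
  qed
  \<comment> \<open>Component moments lie in [0, 1], so the summable weights dominate.\<close>
  have pm_summable: "summable (\<lambda>n. p n * m n)"
    by (rule summable_comparison_test'[OF p_summable, of 0])
      (use p_nonneg m01 in \<open>auto simp: abs_mult intro!: mult_left_le\<close>)
  have "has_bochner_integral M (\<lambda>\<omega>. Y \<omega> ^ r) (\<Sum>n. p n * m n)"
  proof (rule has_bochner_integral_nn_integral)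
    show "AE \<omega> in M. 0 \<le> Y \<omega> ^ r" using AE_Y by eventually_elim simp
    show "0 \<le> (\<Sum>n. p n * m n)" using p_nonneg m01 by (intro suminf_nonneg pm_summable) auto
    have "(\<integral>\<^sup>+\<omega>. ennreal (Y \<omega> ^ r) \<partial>M) = (\<Sum>n. ennreal (p n * m n))"
      by (simp add: nnY[of "\<lambda>y. ennreal (y ^ r)"] m ennreal_mult p_nonneg m01 del: of_nat_Suc)
    also have "\<dots> = ennreal (\<Sum>n. p n * m n)"
      using p_nonneg m01 by (intro suminf_ennreal2 pm_summable) auto
    finally show "(\<integral>\<^sup>+\<omega>. ennreal (Y \<omega> ^ r) \<partial>M) = ennreal (\<Sum>n. p n * m n)" .
  qed simp
  then have Y_int: "integrable M (\<lambda>\<omega>. Y \<omega> ^ r)" "(\<lambda>n. p n * m n) sums (\<integral>\<omega>. Y \<omega> ^ r \<partial>M)"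
    using pm_summable by (auto simp: has_bochner_integral_iff sums_iff)
  have series: "summable (moment_term \<alpha> r (\<nu> * real z))"
      "(\<integral>y. y ^ r \<partial>rGTL \<alpha> (\<nu> * real z)) =
        \<alpha> powr (\<nu> * real z - 1) * Gamma (\<nu> * real z + 1) * (\<Sum>h. moment_term \<alpha> r (\<nu> * real z) h)"
    if "1 \<le> z" "a z \<noteq> 0" for z
    using rGTL_moment_series[OF \<alpha> \<nu>z assms(8)] assms(12) that by auto
  \<comment> \<open>Where a z = 0 both sides vanish, whatever value the inner sum has; elsewhere the
    component formula applies.\<close>
  have "p n * m n = (let z = Suc n in
          a z * \<theta> ^ z / PS_norm a \<theta> * \<alpha> powr (\<nu> * real z - 1) * Gamma (\<nu> * real z + 1)
            * (\<Sum>h. moment_term \<alpha> r (\<nu> * real z) h))" for n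
    using series(2)[of "Suc n"]
    by (cases "a (Suc n) = 0") (simp_all add: p_def m_def PS_prob_def Let_def mult.assoc del: of_nat_Suc)
  with Y_int series(1) show ?thesis by simp
qed

end
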